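(* Consider the two-dimensional risk model with constant interest rate described in the context (with $c_1/\delta_1>c_2/\delta_2$). For $T>0$ and $x_1,x_2$, let $$\Psi_{\min}(x_1,x_2,T)=P\{T_{\min}(\delta_1x_1,\delta_2x_2)\le T\}=P\{\exists\,t\le T:\ X_1(t)<0\text{ or }X_2(t)<0\},$$ where $X_i(t)=x_i+p_i(1-e^{-rt})-\sum_{k=1}^{N(t)}e^{-r\theta_k}\sigma_k$ and $p_i=\frac{c_i}{r\delta_i}$. Let $V$ be uniformly distributed on $(0,T]$, independent of $\sigma_1$, and $F_T(x)=P\{e^{-rV}\sigma_1\le x\}$, $\overline{F_T}=1-F_T$. Suppose $P\{\sigma_k>x\}=L(x)/x^{\alpha}$, where $\alpha>0$ and $L$ is continuous, slowly varying, with $\lim_{x\to\infty}L(x)=\infty$. Then for any $T>0$, $$\lim_{x_2\ge x_1\to\infty}\frac{\Psi_{\min}(x_1,x_2,T)}{\lambda T\,\overline{F_T}(x_1)}=1,$$ the limit being taken as $x_1\to\infty$ over pairs with $x_2\ge x_1$.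
   Context: Model: $U_i(t)=e^{rt}u_i+\frac{c_i}{r}(e^{rt}-1)-\delta_i\sum_{k=1}^{N(t)}e^{r(t-\theta_k)}\sigma_k$, $i=1,2$, where $r>0$ is the interest rate, $u_i$ initial reserves, $c_i>0$ premium rates, $0<\delta_1,\delta_2<1$ with $\delta_1+\delta_2=1$, $N(t)$ a Poisson process with intensity $\lambda>0$, $\{\sigma_k\}$ i.i.d. nonnegative claim sizes independent of $N$, and $\theta_k$ the $k$-th arrival time of $N$. $T_{\min}(u_1,u_2)=\inf\{t\ge0:\min\{U_1(t),U_2(t)\}<0\}$. Standing assumption $c_1/\delta_1>c_2/\delta_2$, i.e. $p_1>p_2$. Note $X_i(t)=e^{-rt}U_i(t)/\delta_i$ with $x_i=u_i/\delta_i$. *)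

theory Defs
  imports "HOL-Probability.Probability"
begin

definition slowly_varying :: "(real \<Rightarrow> real) \<Rightarrow> bool" where
  "slowly_varying L \<longleftrightarrow> L \<in> borel_measurable borel \<and>
     (\<forall>\<^sub>F x in at_top. L x > 0) \<and>
     (\<forall>c>0. ((\<lambda>x. L (c * x) / L x) \<longlongrightarrow> 1) at_top)"

definition arrival :: "(nat \<Rightarrow> 'a \<Rightarrow> real) \<Rightarrow> nat \<Rightarrow> 'a \<Rightarrow> real" where
  "arrival W k \<omega> = (\<Sum>j<k. W j \<omega>)"

definition counting :: "(nat \<Rightarrow> 'a \<Rightarrow> real) \<Rightarrow> real \<Rightarrow> 'a \<Rightarrow> nat" where
  "counting W t \<omega> = card {k. 1 \<le> k \<and> arrival W k \<omega> \<le> t}"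

definition Xproc :: "real \<Rightarrow> (nat \<Rightarrow> 'a \<Rightarrow> real) \<Rightarrow> (nat \<Rightarrow> 'a \<Rightarrow> real)
    \<Rightarrow> real \<Rightarrow> real \<Rightarrow> real \<Rightarrow> 'a \<Rightarrow> real" where
  "Xproc r W \<sigma> x p t \<omega> = x + p * (1 - exp (- r * t))
     - (\<Sum>k\<in>{1..counting W t \<omega>}. exp (- r * arrival W k \<omega>) * \<sigma> k \<omega>)"

definition Psi_min :: "'a measure \<Rightarrow> real \<Rightarrow> (nat \<Rightarrow> 'a \<Rightarrow> real) \<Rightarrow> (nat \<Rightarrow> 'a \<Rightarrow> real)
    \<Rightarrow> real \<Rightarrow> real \<Rightarrow> real \<Rightarrow> real \<Rightarrow> real \<Rightarrow> real" where
  "Psi_min M r W \<sigma> p1 p2 x1 x2 T = measure M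
     {\<omega> \<in> space M. \<exists>t\<in>{0..T}. Xproc r W \<sigma> x1 p1 t \<omega> < 0 \<or> Xproc r W \<sigma> x2 p2 t \<omega> < 0}"

text \<open>F_T(x) = P{e^{-rV} sigma_1 <= x}, V uniform on (0,T] independent of sigma_1:
  the joint law of (V, sigma_1) is the product of the two laws.\<close>
definition F_T :: "'a measure \<Rightarrow> real \<Rightarrow> (nat \<Rightarrow> 'a \<Rightarrow> real) \<Rightarrow> real \<Rightarrow> real \<Rightarrow> real" where
  "F_T M r \<sigma> T x = measure (uniform_measure lborel {0<..T} \<Otimes>\<^sub>M distr M borel (\<sigma> 1))
     {(v, s). exp (- r * v) * s \<le> x}"

definition Fbar_T :: "'a measure \<Rightarrow> real \<Rightarrow> (nat \<Rightarrow> 'a \<Rightarrow> real) \<Rightarrow> real \<Rightarrow> real \<Rightarrow> real" where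
  "Fbar_T M r \<sigma> T x = 1 - F_T M r \<sigma> T x"

end

theory Submission
  imports Defs
begin

text \<open>Ruin by time \<open>T\<close> lies between the events that the discounted claims \<open>S\<close> exceed \<open>x1 + p1\<close>
  and \<open>x1\<close>. By Campbell's formula the expected number of discounted claims above \<open>x\<close> is exactly
  \<open>\<lambda> T Fbar_T(x)\<close>. Bonferroni's inequality bounds the probability of such a claim below by this mean
  up to the expected number of pairs of large claims. Conversely, \<open>S > x\<close> with \<open>n\<close> claims forces
  either one discounted claim above \<open>(1 - e) x\<close> or two claims above \<open>e x / n\<close>. Writing \<open>G\<close> for the
  claim tail, regular variation gives \<open>G(x / 2) \<le> D G(x)\<close> for all \<open>x > 0\<close>, hence \<open>G(x / n) \<le> D^n G(x)\<close>,
  and the factorial decay of \<open>P(\<theta>_n \<le> T)\<close> absorbs \<open>D^(2n)\<close>. So pairs of large claims contribute only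
  \<open>O(G(x)^2)\<close>, which is negligible against \<open>Fbar_T(x)\<close>.\<close>

section \<open>Erlang densities and a Bonferroni inequality\<close>

text \<open>The exponential series cancels \<open>exp (- l * t)\<close>. The sum is the renewal
  density of the Poisson process, which is constant in \<open>t\<close>.\<close>

lemma sums_erlang_density:
  fixes l t :: real
  assumes "0 < l" "0 \<le> t"
  shows "(\<lambda>k. erlang_density k l t) sums l"
proof -
  have "(\<lambda>k. (l * t) ^ k /\<^sub>R fact k) sums exp (l * t)"
    by (rule exp_converges)
  then have "(\<lambda>k. l * exp (- l * t) * ((l * t) ^ k /\<^sub>R fact k)) sums (l * exp (- l * t) * exp (l * t))"
    by (rule sums_mult)
  moreover have "l * exp (- l * t) * exp (l * t) = l"
    by (simp add: exp_minus)
  ultimately show ?thesis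
    using assms by (simp add: erlang_density_def field_simps)
qed

lemma erlang_density_le:
  fixes l t T :: real
  assumes "0 < l" "t \<le> T"  "0 < T"
  shows "erlang_density k l t \<le> l * (l * T) ^ k / fact k"
proof (cases "t < 0")
  case False
  have "(l * t) ^ k * exp (- l * t) \<le> (l * T) ^ k * 1"
    using assms False by (intro mult_mono power_mono) auto
  with assms False show ?thesis
    by (auto simp: erlang_density_def field_simps)
qed (use assms in \<open>simp add: erlang_density_def\<close>)

text \<open>Adding \<open>A n\<close> to the union gains \<open>prob (A n)\<close> minus its overlap
  with the earlier events, and subadditivity bounds that overlap by the pairs
  \<open>(j, n)\<close>.\<close>

lemma (in prob_space) bonferroni_lower:
  fixes A :: "nat \<Rightarrow> 'a set"
  assumes "\<And>k. A k \<in> events"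
  shows "(\<Sum>k<n. prob (A k)) - (\<Sum>k<n. \<Sum>j<k. prob (A j \<inter> A k)) \<le> prob (\<Union>k<n. A k)"
proof (induction n)
  case (Suc n)
  have "prob ((\<Union>k<n. A k) \<inter> A n) = prob (\<Union>j<n. A j \<inter> A n)"
    by (intro arg_cong[where f=prob]) auto
  also have "\<dots> \<le> (\<Sum>j<n. prob (A j \<inter> A n))"
    using assms by (intro finite_measure_subadditive_finite) auto
  finally have "prob ((\<Union>k<n. A k) \<inter> A n) \<le> (\<Sum>j<n. prob (A j \<inter> A n))" .
  moreover have "prob (\<Union>k<Suc n. A k) = prob (\<Union>k<n. A k) + prob (A n) - prob ((\<Union>k<n. A k) \<inter> A n)"
    using assms by (subst measure_Un3[symmetric]) (auto simp: lessThan_Suc Un_commute fmeasurable_eq_sets)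
  ultimately show ?case
    using Suc by simp
qed simp

section \<open>The model and the tail of a claim\<close>

locale discounted_claims = prob_space M for M :: "'a measure" +
  fixes W \<sigma> :: "nat \<Rightarrow> 'a \<Rightarrow> real" and r lam T :: real
  assumes r_pos: "r > 0" and lam_pos: "lam > 0" and T_pos: "T > 0"
    and indep: "indep_vars (\<lambda>_. borel)
           (\<lambda>i. case i of Inl k \<Rightarrow> W k | Inr k \<Rightarrow> \<sigma> k) (range Inl \<union> Inr ` {1..})"
    and exponential: "\<And>k. distributed M lborel (W k) (exponential_density lam)"
    and ident: "\<And>k. k \<ge> 1 \<Longrightarrow> distr M borel (\<sigma> k) = distr M borel (\<sigma> 1)"
    and claim_nonneg: "\<And>k \<omega>. k \<ge> 1 \<Longrightarrow> \<omega> \<in> space M \<Longrightarrow> \<sigma> k \<omega> \<ge> 0"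
begin

definition tail :: "real \<Rightarrow> real" where
  "tail x = prob {\<omega> \<in> space M. \<sigma> 1 \<omega> > x}"

text \<open>The index is shifted: event \<open>k\<close> concerns claim \<open>Suc k\<close>, whose
  arrival time has density \<open>erlang_density k lam\<close>.\<close>

definition large_claim :: "real \<Rightarrow> nat \<Rightarrow> 'a set" where
  "large_claim x k = {\<omega> \<in> space M. arrival W (Suc k) \<omega> \<le> T \<and>
     exp (- r * arrival W (Suc k) \<omega>) * \<sigma> (Suc k) \<omega> > x}"

lemma measurable_W [measurable]: "W k \<in> borel_measurable M"
  using exponential[of k] by (simp add: distributed_def)

lemma measurable_claim: "k \<ge> 1 \<Longrightarrow> \<sigma> k \<in> borel_measurable M"
  using indep unfolding indep_vars_def by force

lemma measurable_claim_Suc [measurable]: "\<sigma> (Suc k) \<in> borel_measurable M"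
  by (rule measurable_claim) simp

lemma measurable_claim_1 [measurable]: "\<sigma> 1 \<in> borel_measurable M"
  by (rule measurable_claim) simp

lemma measurable_arrival [measurable]: "arrival W k \<in> borel_measurable M"
  unfolding arrival_def[abs_def] by measurable

lemma large_claim_sets [measurable]: "large_claim x k \<in> sets M"
  unfolding large_claim_def by measurable

lemma prob_claim_greater:
  assumes "k \<ge> 1"
  shows "prob {\<omega> \<in> space M. \<sigma> k \<omega> > x} = tail x"
proof -
  have "prob {\<omega> \<in> space M. \<sigma> k \<omega> > x} = measure (distr M borel (\<sigma> k)) {x<..}"
    using measurable_claim[OF assms]
    by (subst measure_distr) (auto intro!: arg_cong[where f=prob])
  also have "\<dots> = tail x"
    unfolding ident[OF assms] tail_def
    by (subst measure_distr) (auto intro!: arg_cong[where f=prob])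
  finally show ?thesis .
qed

lemma tail_nonneg [simp]: "0 \<le> tail x"
  by (simp add: tail_def)

lemma tail_le_1: "tail x \<le> 1"
  by (simp add: tail_def)

lemma tail_antimono: "x \<le> y \<Longrightarrow> tail y \<le> tail x"
  unfolding tail_def by (intro finite_measure_mono) auto

lemma measurable_tail [measurable]: "tail \<in> borel_measurable borel"
proof -
  have "(\<lambda>x. - tail x) \<in> borel_measurable borel"
    by (intro borel_measurable_mono monoI) (simp add: tail_antimono)
  from borel_measurable_uminus[OF this] show ?thesis
    by simp
qed

lemma tail_tendsto_0: "(tail \<longlongrightarrow> 0) at_top"
proof -
  interpret D: real_distribution "distr M borel (\<sigma> 1)"
    by (rule real_distribution_distr) measurable
  have "tail x = 1 - cdf (distr M borel (\<sigma> 1)) x" for x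
  proof -
    have "prob {\<omega> \<in> space M. \<not> \<sigma> 1 \<omega> > x} = 1 - tail x"
      unfolding tail_def by (rule prob_neg) measurable
    then show ?thesis
      by (simp add: cdf_def measure_distr not_less vimage_def Int_def conj_commute)
  qed
  then have *: "tail = (\<lambda>x. 1 - cdf (distr M borel (\<sigma> 1)) x)"
    by blast
  have "((\<lambda>x. 1 - cdf (distr M borel (\<sigma> 1)) x) \<longlongrightarrow> 1 - 1) at_top"
    by (intro tendsto_intros D.cdf_lim_at_top_prob)
  then show ?thesis
    unfolding * by simp
qed

section \<open>Law of the arrival times and independence of the claims\<close>

lemma arrival_erlang: "distributed M lborel (arrival W (Suc k)) (erlang_density k lam)"
proof -
  let ?X = "\<lambda>i. case i of Inl k \<Rightarrow> W k | Inr k \<Rightarrow> \<sigma> k" and ?I = "Inl ` {..<Suc k} :: (nat + nat) set"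
  have "distributed M lborel (\<lambda>\<omega>. \<Sum>i\<in>?I. ?X i \<omega>) (erlang_density (card ?I - 1) lam)"
    using exponential
    by (intro exponential_distributed_sum lam_pos indep_vars_subset[OF indep]) auto
  moreover have "(\<Sum>i\<in>?I. ?X i \<omega>) = arrival W (Suc k) \<omega>" for \<omega>
    unfolding arrival_def by (subst sum.reindex) auto
  ultimately show ?thesis
    by (simp add: card_image)
qed

text \<open>Disjoint blocks of the independent family give independent vectors; the arrival time is
  a sum over one block, the claim a projection of the other.\<close>

lemma indep_arrival_claim: "indep_var borel (arrival W n) borel (\<sigma> (Suc k))"
proof -
  let ?X = "\<lambda>i. case i of Inl k \<Rightarrow> W k | Inr k \<Rightarrow> \<sigma> k"
  let ?A = "Inl ` {..<n} :: (nat + nat) set" and ?B = "{Inr (Suc k)} :: (nat + nat) set"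
  have "indep_var (PiM ?A (\<lambda>_. borel)) (\<lambda>\<omega>. restrict (\<lambda>i. ?X i \<omega>) ?A)
      (PiM ?B (\<lambda>_. borel)) (\<lambda>\<omega>. restrict (\<lambda>i. ?X i \<omega>) ?B)"
    by (rule indep_var_restrict[OF indep]) auto
  then have "indep_var borel ((\<lambda>f. \<Sum>j<n. f (Inl j)) \<circ> (\<lambda>\<omega>. restrict (\<lambda>i. ?X i \<omega>) ?A))
     borel ((\<lambda>f. f (Inr (Suc k))) \<circ> (\<lambda>\<omega>. restrict (\<lambda>i. ?X i \<omega>) ?B))"
    by (rule indep_var_compose) measurable
  then show ?thesis
    by (simp add: comp_def arrival_def[abs_def])
qed

text \<open>Both claims exceed \<open>x\<close> exactly when their minimum does. This reduces the
  event to two independent blocks, and the product rule for the two claims yields the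
  square.\<close>

lemma prob_arrival_two_claims:
  assumes "j \<noteq> k"
  shows "prob {\<omega> \<in> space M. arrival W n \<omega> \<le> T \<and> \<sigma> (Suc j) \<omega> > x \<and> \<sigma> (Suc k) \<omega> > x}
    = prob {\<omega> \<in> space M. arrival W n \<omega> \<le> T} * (tail x)\<^sup>2"
proof -
  let ?X = "\<lambda>i. case i of Inl k \<Rightarrow> W k | Inr k \<Rightarrow> \<sigma> k"
  let ?A = "Inl ` {..<n} :: (nat + nat) set" and ?B = "{Inr (Suc j), Inr (Suc k)} :: (nat + nat) set"
  have "indep_var (PiM ?A (\<lambda>_. borel)) (\<lambda>\<omega>. restrict (\<lambda>i. ?X i \<omega>) ?A)
      (PiM ?B (\<lambda>_. borel)) (\<lambda>\<omega>. restrict (\<lambda>i. ?X i \<omega>) ?B)"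
    by (rule indep_var_restrict[OF indep]) auto
  then have "indep_var borel ((\<lambda>f. \<Sum>j<n. f (Inl j)) \<circ> (\<lambda>\<omega>. restrict (\<lambda>i. ?X i \<omega>) ?A))
     borel ((\<lambda>f. min (f (Inr (Suc j))) (f (Inr (Suc k)))) \<circ> (\<lambda>\<omega>. restrict (\<lambda>i. ?X i \<omega>) ?B))"
    by (rule indep_var_compose) measurable
  then have *: "indep_var borel (arrival W n) borel (\<lambda>\<omega>. min (\<sigma> (Suc j) \<omega>) (\<sigma> (Suc k) \<omega>))"
    by (simp add: comp_def arrival_def[abs_def])
  have "prob (\<Inter>i\<in>?B. ?X i -` {x<..} \<inter> space M) = (\<Prod>i\<in>?B. prob (?X i -` {x<..} \<inter> space M))"
    by (rule indep_varsD[OF indep]) auto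
  also have "\<dots> = prob {\<omega> \<in> space M. \<sigma> (Suc j) \<omega> > x} * prob {\<omega> \<in> space M. \<sigma> (Suc k) \<omega> > x}"
    using assms by (simp add: vimage_def Int_def conj_commute)
  finally have "prob (\<Inter>i\<in>?B. ?X i -` {x<..} \<inter> space M) = (tail x)\<^sup>2"
    by (simp add: prob_claim_greater power2_eq_square)
  moreover have "(\<Inter>i\<in>?B. ?X i -` {x<..} \<inter> space M)
      = (\<lambda>\<omega>. min (\<sigma> (Suc j) \<omega>) (\<sigma> (Suc k) \<omega>)) -` {x<..} \<inter> space M"
    by auto
  ultimately have **: "prob ((\<lambda>\<omega>. min (\<sigma> (Suc j) \<omega>) (\<sigma> (Suc k) \<omega>)) -` {x<..} \<inter> space M) = (tail x)\<^sup>2"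
    by simp
  have "{\<omega> \<in> space M. arrival W n \<omega> \<le> T \<and> \<sigma> (Suc j) \<omega> > x \<and> \<sigma> (Suc k) \<omega> > x}
    = (\<lambda>\<omega>. (arrival W n \<omega>, min (\<sigma> (Suc j) \<omega>) (\<sigma> (Suc k) \<omega>))) -` ({..T} \<times> {x<..}) \<inter> space M"
    by auto
  then show ?thesis
    using indep_varD[OF *, of "{..T}" "{x<..}"] **
    by (simp add: vimage_def Int_def conj_commute)
qed

section \<open>Campbell's formula for the number of large discounted claims\<close>

text \<open>Condition on the arrival time: by independence the joint law is a product, and a claim
  arriving at \<open>t\<close> must exceed \<open>x * exp (r * t)\<close>.\<close>

lemma emeasure_large_claim:
  "emeasure M (large_claim x k) =
     (\<integral>\<^sup>+t. ennreal (erlang_density k lam t * tail (x * exp (r * t))) * indicator {0<..T} t \<partial>lborel)"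
proof -
  let ?D = "density lborel (erlang_density k lam)"
  let ?C = "distr M borel (\<sigma> (Suc k))"
  let ?S = "{(t, s). t \<le> T \<and> exp (- r * t) * s > x}"
  interpret C: prob_space ?C
    by (rule prob_space_distr) measurable
  have eq: "distr M borel (arrival W (Suc k)) \<Otimes>\<^sub>M ?C
      = distr M (borel \<Otimes>\<^sub>M borel) (\<lambda>\<omega>. (arrival W (Suc k) \<omega>, \<sigma> (Suc k) \<omega>))"
    using indep_arrival_claim[of "Suc k" k] by (simp add: indep_var_distribution_eq)
  have sets: "sets (?D \<Otimes>\<^sub>M ?C) = sets (borel \<Otimes>\<^sub>M borel)"
    by (simp cong: sets_pair_measure_cong)
  have D: "distr M borel (arrival W (Suc k)) = ?D"
    using arrival_erlang[of k] by (simp add: distributed_def cong: distr_cong)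
  have "{p \<in> space (borel \<Otimes>\<^sub>M borel). fst p \<le> T \<and> exp (- r * fst p) * snd p > x}
      \<in> sets (borel \<Otimes>\<^sub>M borel)"
    by measurable
  moreover have "{p \<in> space (borel \<Otimes>\<^sub>M borel). fst p \<le> T \<and> exp (- r * fst p) * snd p > x} = ?S"
    by (auto simp: space_pair_measure)
  ultimately have S: "?S \<in> sets (borel \<Otimes>\<^sub>M borel)"
    by (simp only:)
  have "emeasure M (large_claim x k)
     = emeasure (distr M (borel \<Otimes>\<^sub>M borel) (\<lambda>\<omega>. (arrival W (Suc k) \<omega>, \<sigma> (Suc k) \<omega>))) ?S"
    by (subst emeasure_distr[OF _ S]) (auto simp: large_claim_def intro!: arg_cong[where f="emeasure M"])
  also have "\<dots> = emeasure (?D \<Otimes>\<^sub>M ?C) ?S"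
    by (simp add: eq[symmetric] D)
  also have "\<dots> = (\<integral>\<^sup>+t. emeasure ?C (Pair t -` ?S) \<partial>?D)"
    by (rule C.emeasure_pair_measure_alt) (simp only: sets S)
  also have "\<dots> = (\<integral>\<^sup>+t. indicator {..T} t * ennreal (tail (x * exp (r * t))) \<partial>?D)"
  proof (rule nn_integral_cong)
    fix t
    have "x * exp (r * t) < s \<longleftrightarrow> x < exp (- r * t) * s" for s
      by (simp add: exp_minus field_simps)
    then have "Pair t -` ?S = (if t \<le> T then {x * exp (r * t)<..} else {})"
      by (auto simp: vimage_def)
    moreover have "emeasure ?C {y<..} = tail y" for y
      using prob_claim_greater[of "Suc k" y]
      by (subst emeasure_distr) (auto simp: emeasure_eq_measure vimage_def Int_def conj_commute)
    ultimately show "emeasure ?C (Pair t -` ?S) = indicator {..T} t * ennreal (tail (x * exp (r * t)))"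
      by simp
  qed
  also have "\<dots> = (\<integral>\<^sup>+t. ennreal (erlang_density k lam t) * (indicator {..T} t * ennreal (tail (x * exp (r * t)))) \<partial>lborel)"
    by (subst nn_integral_density) (auto intro!: measurable_compose[OF _ measurable_tail])
  \<comment> \<open>The density vanishes for negative \<open>t\<close> and the point 0 is null, so
    the range becomes \<open>{0<..T}\<close>, the support of the uniform law in
    \<open>F_T\<close>.\<close>
  also have "\<dots> = (\<integral>\<^sup>+t. ennreal (erlang_density k lam t * tail (x * exp (r * t))) * indicator {0<..T} t \<partial>lborel)"
  proof (rule nn_integral_cong_AE, use AE_lborel_singleton[of 0] in eventually_elim)
    fix t :: real assume "t \<noteq> 0"
    then show "ennreal (erlang_density k lam t) * (indicator {..T} t * ennreal (tail (x * exp (r * t))))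
      = ennreal (erlang_density k lam t * tail (x * exp (r * t))) * indicator {0<..T} t"
      by (auto simp: indicator_def erlang_density_def ennreal_mult'')
  qed
  finally show ?thesis .
qed

text \<open>Conditioning on \<open>V\<close> and cancelling the uniform density \<open>1 / T\<close>
  gives the integral of \<open>emeasure_large_claim\<close> with the Erlang density replaced by the
  constant \<open>lam\<close>.\<close>

lemma claim_mean_eq:
  "ennreal (lam * T * Fbar_T M r \<sigma> T x) =
     (\<integral>\<^sup>+t. ennreal (lam * tail (x * exp (r * t))) * indicator {0<..T} t \<partial>lborel)"
proof -
  let ?U = "uniform_measure lborel {0<..T}"
  let ?C = "distr M borel (\<sigma> 1)"
  let ?S = "{(t, s). exp (- r * t) * s > x}"
  interpret C: prob_space ?C
    by (rule prob_space_distr) measurable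
  interpret U: prob_space ?U
    using T_pos by (intro prob_space_uniform_measure) auto
  interpret P: pair_prob_space ?U ?C ..
  have sets: "sets (?U \<Otimes>\<^sub>M ?C) = sets (borel \<Otimes>\<^sub>M borel)"
    by (simp cong: sets_pair_measure_cong)
  have "{p \<in> space (borel \<Otimes>\<^sub>M borel). exp (- r * fst p) * snd p > x} \<in> sets (borel \<Otimes>\<^sub>M borel)"
    by measurable
  moreover have "{p \<in> space (borel \<Otimes>\<^sub>M borel). exp (- r * fst p) * snd p > x} = ?S"
    by (auto simp: space_pair_measure)
  ultimately have S: "?S \<in> sets (?U \<Otimes>\<^sub>M ?C)"
    by (simp only: sets)
  have "{(t, s). exp (- r * t) * s \<le> x} = space (?U \<Otimes>\<^sub>M ?C) - ?S"
    by (auto simp: space_pair_measure)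
  then have "Fbar_T M r \<sigma> T x = measure (?U \<Otimes>\<^sub>M ?C) ?S"
    using P.prob_compl[OF S] by (simp add: Fbar_T_def F_T_def)
  then have "ennreal (Fbar_T M r \<sigma> T x) = emeasure (?U \<Otimes>\<^sub>M ?C) ?S"
    by (simp only: P.emeasure_eq_measure)
  also have "\<dots> = (\<integral>\<^sup>+t. emeasure ?C (Pair t -` ?S) \<partial>?U)"
    by (rule C.emeasure_pair_measure_alt[OF S])
  also have "\<dots> = (\<integral>\<^sup>+t. ennreal (tail (x * exp (r * t))) \<partial>?U)"
  proof (rule nn_integral_cong)
    fix t
    have "x * exp (r * t) < s \<longleftrightarrow> x < exp (- r * t) * s" for s
      by (simp add: exp_minus field_simps)
    then have "Pair t -` ?S = {x * exp (r * t)<..}"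
      by (auto simp: vimage_def)
    then show "emeasure ?C (Pair t -` ?S) = ennreal (tail (x * exp (r * t)))"
      using prob_claim_greater[of 1 "x * exp (r * t)"]
      by (simp add: emeasure_distr emeasure_eq_measure vimage_def Int_def conj_commute)
  qed
  also have "\<dots> = (\<integral>\<^sup>+t. ennreal (tail (x * exp (r * t))) * indicator {0<..T} t \<partial>lborel) / ennreal T"
    using T_pos by (subst nn_integral_uniform_measure) (auto intro!: measurable_compose[OF _ measurable_tail])
  finally have "ennreal T * ennreal (Fbar_T M r \<sigma> T x)
      = (\<integral>\<^sup>+t. ennreal (tail (x * exp (r * t))) * indicator {0<..T} t \<partial>lborel)"
    using T_pos by (simp add: mult.commute[of "ennreal T"] ennreal_divide_times ennreal_mult_divide_eq)
  then have "ennreal lam * (ennreal T * ennreal (Fbar_T M r \<sigma> T x))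
      = (\<integral>\<^sup>+t. ennreal lam * (ennreal (tail (x * exp (r * t))) * indicator {0<..T} t) \<partial>lborel)"
    by (subst nn_integral_cmult) (auto intro!: measurable_compose[OF _ measurable_tail])
  moreover have "ennreal (lam * T * Fbar_T M r \<sigma> T x) = ennreal lam * (ennreal T * ennreal (Fbar_T M r \<sigma> T x))"
    using lam_pos T_pos by (simp add: ennreal_mult' mult.assoc)
  ultimately show ?thesis
    using lam_pos by (simp add: ennreal_mult' mult.assoc)
qed


lemma Fbar_T_nonneg: "0 \<le> Fbar_T M r \<sigma> T x"
proof -
  interpret C: prob_space "distr M borel (\<sigma> 1)"
    by (rule prob_space_distr) measurable
  interpret U: prob_space "uniform_measure lborel {0<..T}"
    using T_pos by (intro prob_space_uniform_measure) auto
  interpret P: pair_prob_space "uniform_measure lborel {0<..T}" "distr M borel (\<sigma> 1)" ..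
  show ?thesis
    using P.prob_le_1 by (simp add: Fbar_T_def F_T_def)
qed

text \<open>Campbell's formula; the Erlang densities add up to the intensity of the process.\<close>

lemma sums_large_claim: "(\<lambda>k. prob (large_claim x k)) sums (lam * T * Fbar_T M r \<sigma> T x)"
proof -
  have "(\<Sum>k. emeasure M (large_claim x k)) = (\<integral>\<^sup>+t. (\<Sum>k. ennreal (erlang_density k lam t *
      tail (x * exp (r * t))) * indicator {0<..T} t) \<partial>lborel)"
    unfolding emeasure_large_claim
    by (subst nn_integral_suminf) (auto intro!: measurable_compose[OF _ measurable_tail])
  also have "\<dots> = ennreal (lam * T * Fbar_T M r \<sigma> T x)"
    unfolding claim_mean_eq
  proof (rule nn_integral_cong)
    fix t
    show "(\<Sum>k. ennreal (erlang_density k lam t * tail (x * exp (r * t))) * indicator {0<..T} t)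
       = ennreal (lam * tail (x * exp (r * t))) * indicator {0<..T} t"
    proof (cases "t \<in> {0<..T}")
      case True
      then have "(\<lambda>k. erlang_density k lam t * tail (x * exp (r * t))) sums (lam * tail (x * exp (r * t)))"
        using lam_pos by (intro sums_mult2 sums_erlang_density) auto
      then have "(\<Sum>k. ennreal (erlang_density k lam t * tail (x * exp (r * t)))) = ennreal (lam * tail (x * exp (r * t)))"
        using lam_pos by (intro suminf_ennreal_eq) auto
      with True show ?thesis
        by simp
    qed simp
  qed
  finally have *: "(\<Sum>k. ennreal (prob (large_claim x k))) = ennreal (lam * T * Fbar_T M r \<sigma> T x)"
    by (simp add: emeasure_eq_measure)
  then have sm: "summable (\<lambda>k. prob (large_claim x k))"
    by (intro summable_suminf_not_top) auto
  moreover from * sm have "(\<Sum>k. prob (large_claim x k)) = lam * T * Fbar_T M r \<sigma> T x"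
    using lam_pos T_pos Fbar_T_nonneg[of x]
    by (subst (asm) suminf_ennreal2) (auto simp: ennreal_inj suminf_nonneg)
  ultimately show ?thesis
    by (simp add: sums_iff)
qed

section \<open>Factorial decay of the arrival probabilities\<close>

lemma prob_arrival_le: "prob {\<omega> \<in> space M. arrival W (Suc k) \<omega> \<le> T} \<le> (lam * T) ^ Suc k / fact k"
proof -
  let ?c = "lam * (lam * T) ^ k / fact k"
  have c: "0 \<le> ?c"
    using lam_pos T_pos by simp
  have "emeasure M {\<omega> \<in> space M. arrival W (Suc k) \<omega> \<le> T}
      = emeasure M (arrival W (Suc k) -` {..T} \<inter> space M)"
    by (auto intro!: arg_cong[where f="emeasure M"])
  also have "\<dots> = (\<integral>\<^sup>+t. ennreal (erlang_density k lam t) * indicator {..T} t \<partial>lborel)"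
    by (rule distributed_emeasure[OF arrival_erlang]) simp
  also have "\<dots> \<le> (\<integral>\<^sup>+t. ennreal ?c * indicator {0..T} t \<partial>lborel)"
  proof (rule nn_integral_mono)
    fix t
    show "ennreal (erlang_density k lam t) * indicator {..T} t \<le> ennreal ?c * indicator {0..T} t"
      using erlang_density_le[of lam t T k] lam_pos T_pos
      by (cases "t < 0") (auto simp: indicator_def erlang_density_def intro!: ennreal_leI)
  qed
  also have "\<dots> = ennreal (?c * T)"
    using c T_pos by (simp add: nn_integral_cmult_indicator ennreal_mult del: times_divide_eq_left times_divide_eq_right)
  finally show ?thesis
    using c T_pos lam_pos by (simp add: emeasure_eq_measure ac_simps)
qed

text \<open>The square will count pairs among \<open>Suc k\<close> claims, and \<open>D ^ k\<close>
  will pay for lowering the tail level. Since the square is at most \<open>4 ^ Suc k\<close>, an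
  exponential series dominates.\<close>

lemma summable_arrival:
  assumes "0 \<le> D"
  shows "summable (\<lambda>k. prob {\<omega> \<in> space M. arrival W (Suc k) \<omega> \<le> T} * (real (Suc k))\<^sup>2 * D ^ k)"
proof (rule summable_comparison_test_ev)
  show "summable (\<lambda>k. 4 * lam * T * (inverse (fact k) * (4 * lam * T * D) ^ k))"
    by (intro summable_mult summable_exp)
  have "prob {\<omega> \<in> space M. arrival W (Suc k) \<omega> \<le> T} * (real (Suc k))\<^sup>2 * D ^ k
      \<le> 4 * lam * T * (inverse (fact k) * (4 * lam * T * D) ^ k)" for k
  proof -
    have "real (Suc k) \<le> 2 ^ Suc k"
      using less_imp_le[OF of_nat_less_two_power[where 'a=real, of "Suc k"]] by simp
    then have "(real (Suc k))\<^sup>2 \<le> (2 ^ Suc k)\<^sup>2"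
      by (intro power_mono) auto
    then have "(real (Suc k))\<^sup>2 \<le> 4 ^ Suc k"
      by (simp add: power2_eq_square flip: power_mult_distrib)
    then have "prob {\<omega> \<in> space M. arrival W (Suc k) \<omega> \<le> T} * (real (Suc k))\<^sup>2 * D ^ k
        \<le> (lam * T) ^ Suc k / fact k * 4 ^ Suc k * D ^ k"
      using assms lam_pos T_pos by (intro mult_mono prob_arrival_le) auto
    also have "\<dots> = 4 * lam * T * (inverse (fact k) * (4 * lam * T * D) ^ k)"
      by (simp add: field_simps power_mult_distrib)
    finally show ?thesis .
  qed
  then show "\<forall>\<^sub>F k in sequentially. norm (prob {\<omega> \<in> space M. arrival W (Suc k) \<omega> \<le> T} * (real (Suc k))\<^sup>2 * D ^ k)
      \<le> 4 * lam * T * (inverse (fact k) * (4 * lam * T * D) ^ k)"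
    using assms by (intro always_eventually allI) simp
qed

section \<open>Paths with ordered arrivals, finitely many up to the horizon\<close>

text \<open>\<open>counting\<close> is a cardinality, hence 0 on a path with infinitely many
  arrivals up to the given time. These conditions exclude that and order the arrivals.\<close>

definition regular_arrivals :: "'a \<Rightarrow> bool" where
  "regular_arrivals \<omega> \<longleftrightarrow> (\<forall>k. 0 \<le> W k \<omega>) \<and> (\<exists>n. T < arrival W n \<omega>)"

lemma AE_regular_arrivals: "AE \<omega> in M. regular_arrivals \<omega>"
proof -
  have "AE \<omega> in M. 0 \<le> W k \<omega>" for k
    unfolding distributed_AE2[OF exponential, of "\<lambda>x. 0 \<le> x", simplified]
    by (auto simp: exponential_density_def)
  moreover have "AE \<omega> in M. \<exists>n. T < arrival W n \<omega>"
  proof -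
    let ?N = "{\<omega> \<in> space M. \<forall>n. arrival W n \<omega> \<le> T}"
    \<comment> \<open>Terms of a convergent series tend to zero. Taking \<open>D = 1\<close> and
      keeping the square, which is at least 1, leaves an upper bound for
      \<open>prob ?N\<close>.\<close>
    have "(\<lambda>k. prob {\<omega> \<in> space M. arrival W (Suc k) \<omega> \<le> T} * (real (Suc k))\<^sup>2 * 1 ^ k) \<longlonglongrightarrow> 0"
      by (intro summable_LIMSEQ_zero summable_arrival) simp
    moreover have "prob ?N \<le> prob {\<omega> \<in> space M. arrival W (Suc k) \<omega> \<le> T} * (real (Suc k))\<^sup>2 * 1 ^ k" for k
    proof -
      have "prob ?N \<le> prob {\<omega> \<in> space M. arrival W (Suc k) \<omega> \<le> T} * 1"
        by (auto intro!: finite_measure_mono)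
      also have "\<dots> \<le> prob {\<omega> \<in> space M. arrival W (Suc k) \<omega> \<le> T} * (real (Suc k))\<^sup>2"
        by (intro mult_left_mono) (auto simp: one_le_power)
      finally show ?thesis
        by simp
    qed
    ultimately have "prob ?N \<le> 0"
      by (intro LIMSEQ_le_const[where a="prob ?N"]) auto
    then have "prob ?N = 0"
      by (simp add: measure_le_0_iff)
    moreover have "?N \<in> sets M"
      by measurable
    ultimately show ?thesis
      by (subst AE_iff_measurable[OF \<open>?N \<in> sets M\<close>]) (auto simp: not_less emeasure_eq_measure)
  qed
  ultimately show ?thesis
    unfolding regular_arrivals_def by (simp add: AE_all_countable)
qed

lemma arrival_mono:
  assumes "\<And>k. 0 \<le> W k \<omega>" "m \<le> n"
  shows "arrival W m \<omega> \<le> arrival W n \<omega>"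
  unfolding arrival_def using assms by (intro sum_mono2) auto

text \<open>Monotone arrival times make the index set downward closed and an arrival after
  \<open>T\<close> makes it finite, so it is an initial segment.\<close>

lemma counting_regular:
  assumes "regular_arrivals \<omega>" "t \<le> T"
  shows "{1..counting W t \<omega>} = {k. 1 \<le> k \<and> arrival W k \<omega> \<le> t}"
proof -
  let ?A = "{k. 1 \<le> k \<and> arrival W k \<omega> \<le> t}"
  from assms obtain N where N: "t < arrival W N \<omega>"
    unfolding regular_arrivals_def by (meson le_less_trans)
  from assms have W: "\<And>k. 0 \<le> W k \<omega>"
    by (simp add: regular_arrivals_def)
  have "k < N" if "k \<in> ?A" for k
    using that N arrival_mono[OF W, of N k] by (cases "k < N") auto
  then have fin: "finite ?A"
    by (intro finite_subset[of ?A "{..<N}"]) auto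
  show ?thesis
  proof (cases "?A = {}")
    case True
    then show ?thesis
      unfolding counting_def True by simp
  next
    case False
    define n where "n = Max ?A"
    have "?A = {1..n}"
    proof (intro set_eqI iffI)
      fix k assume "k \<in> ?A" then show "k \<in> {1..n}"
        using fin by (auto simp: n_def)
    next
      fix k assume k: "k \<in> {1..n}"
      have "n \<in> ?A"
        unfolding n_def using fin False by (rule Max_in)
      with k arrival_mono[OF W, of k n] show "k \<in> ?A"
        by auto
    qed
    then show ?thesis
      by (simp add: counting_def)
  qed
qed

section \<open>Pairs of large claims\<close>

text \<open>The claims are left undiscounted so that the probability factorizes into an arrival
  probability and a squared tail.\<close>

definition two_large_claims :: "real \<Rightarrow> nat \<Rightarrow> 'a set" where
  "two_large_claims x k = {\<omega> \<in> space M. arrival W (Suc k) \<omega> \<le> T \<and>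
     (\<exists>j\<le>k. \<exists>i<j. \<sigma> (Suc i) \<omega> > x \<and> \<sigma> (Suc j) \<omega> > x)}"

lemma two_large_claims_sets [measurable]: "two_large_claims x k \<in> sets M"
  unfolding two_large_claims_def by measurable

text \<open>Union bound over off-diagonal index pairs, which all have the same probability; adding
  the diagonal rounds their number up to a square.\<close>

lemma prob_two_large_claims_le:
  "prob (two_large_claims x k) \<le> prob {\<omega> \<in> space M. arrival W (Suc k) \<omega> \<le> T} * (real (Suc k))\<^sup>2 * (tail x)\<^sup>2"
proof -
  let ?I = "{p \<in> {..k} \<times> {..k}. fst p \<noteq> snd p}"
  let ?B = "\<lambda>p. {\<omega> \<in> space M. arrival W (Suc k) \<omega> \<le> T \<and> \<sigma> (Suc (fst p)) \<omega> > x \<and> \<sigma> (Suc (snd p)) \<omega> > x}"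
  let ?c = "prob {\<omega> \<in> space M. arrival W (Suc k) \<omega> \<le> T} * (tail x)\<^sup>2"
  have "prob (two_large_claims x k) \<le> prob (\<Union>p\<in>?I. ?B p)"
  proof (rule finite_measure_mono)
    show "two_large_claims x k \<subseteq> (\<Union>p\<in>?I. ?B p)"
    proof
      fix \<omega> assume "\<omega> \<in> two_large_claims x k"
      then obtain i j where "j \<le> k" "i < j" and "\<omega> \<in> ?B (i, j)"
        by (auto simp: two_large_claims_def)
      moreover from this have "(i, j) \<in> ?I"
        by auto
      ultimately show "\<omega> \<in> (\<Union>p\<in>?I. ?B p)"
        by blast
    qed
  qed (intro sets.finite_UN, auto)
  also have "\<dots> \<le> (\<Sum>p\<in>?I. prob (?B p))"
    by (rule finite_measure_subadditive_finite) auto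
  also have "\<dots> = (\<Sum>p\<in>?I. ?c)"
    by (intro sum.cong refl prob_arrival_two_claims) auto
  also have "\<dots> \<le> (\<Sum>p\<in>{..k} \<times> {..k}. ?c)"
    by (rule sum_mono2) auto
  also have "\<dots> = prob {\<omega> \<in> space M. arrival W (Suc k) \<omega> \<le> T} * (real (Suc k))\<^sup>2 * (tail x)\<^sup>2"
    by (simp add: card_cartesian_product power2_eq_square algebra_simps)
  finally show ?thesis .
qed

section \<open>The ruin event: measurability and inclusions\<close>

definition ruin :: "real \<Rightarrow> real \<Rightarrow> real \<Rightarrow> real \<Rightarrow> 'a set" where
  "ruin x1 p1 x2 p2 = {\<omega> \<in> space M. \<exists>t\<in>{0..T}. Xproc r W \<sigma> x1 p1 t \<omega> < 0 \<or> Xproc r W \<sigma> x2 p2 t \<omega> < 0}"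

text \<open>On an interval without arrivals the surplus increases, so the uncountably many ruin times
  may be replaced by zero and the arrival times.\<close>

lemma surplus_negative_iff:
  assumes "0 \<le> x" "0 \<le> p"
  shows "(\<exists>t\<in>{0..T}. Xproc r W \<sigma> x p t \<omega> < 0) \<longleftrightarrow>
    (\<exists>k. max 0 (arrival W k \<omega>) \<le> T \<and> Xproc r W \<sigma> x p (max 0 (arrival W k \<omega>)) \<omega> < 0)"
proof safe
  fix t assume t: "t \<in> {0..T}" and neg: "Xproc r W \<sigma> x p t \<omega> < 0"
  let ?A = "{k. 1 \<le> k \<and> arrival W k \<omega> \<le> t}"
  have "counting W t \<omega> \<noteq> 0"
  proof
    assume "counting W t \<omega> = 0"
    then have "Xproc r W \<sigma> x p t \<omega> = x + p * (1 - exp (- r * t))"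
      by (simp add: Xproc_def)
    moreover have "exp (- r * t) \<le> 1"
      using t r_pos by simp
    ultimately show False
      using neg assms mult_nonneg_nonneg[of p "1 - exp (- r * t)"] by linarith
  qed
  \<comment> \<open>A nonzero cardinality means finite and nonempty, so a latest arrival exists on
    any path, regular or not.\<close>
  then have A: "finite ?A" "?A \<noteq> {}"
    unfolding counting_def card_eq_0_iff by blast+
  have "Max ((\<lambda>k. arrival W k \<omega>) ` ?A) \<in> (\<lambda>k. arrival W k \<omega>) ` ?A"
    using A by (intro Max_in) auto
  then obtain k where k: "k \<in> ?A" and k_eq: "arrival W k \<omega> = Max ((\<lambda>k. arrival W k \<omega>) ` ?A)"
    by auto
  have max: "arrival W j \<omega> \<le> arrival W k \<omega>" if "j \<in> ?A" for j
    unfolding k_eq by (rule Max_ge) (use A that in auto)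
  \<comment> \<open>Arrival times may be negative on exceptional paths; truncation at 0 keeps the
    time in \<open>{0..T}\<close>.\<close>
  define \<tau> where "\<tau> = max 0 (arrival W k \<omega>)"
  have \<tau>: "\<tau> \<le> t"
    using t k by (auto simp: \<tau>_def)
  \<comment> \<open>No arrival falls after \<open>\<tau>\<close> and up to \<open>t\<close>, so both
    times have the same claim total, and going back to \<open>\<tau>\<close> can only lower the
    premium income.\<close>
  have "{j. 1 \<le> j \<and> arrival W j \<omega> \<le> \<tau>} = ?A"
    using \<tau> max by (fastforce simp: \<tau>_def)
  then have "counting W \<tau> \<omega> = counting W t \<omega>"
    by (simp add: counting_def)
  moreover have "p * (1 - exp (- r * \<tau>)) \<le> p * (1 - exp (- r * t))"
    using \<tau> assms r_pos by (intro mult_left_mono) auto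
  ultimately have "Xproc r W \<sigma> x p \<tau> \<omega> < 0"
    using neg by (simp add: Xproc_def)
  then show "\<exists>k. max 0 (arrival W k \<omega>) \<le> T \<and> Xproc r W \<sigma> x p (max 0 (arrival W k \<omega>)) \<omega> < 0"
    using \<tau> t by (intro exI[of _ k]) (auto simp: \<tau>_def)
qed auto

text \<open>\<open>surplus_negative_iff\<close> makes the quantifier over times countable. The sum
  with a random number of terms is measurable because that number has countably many values.\<close>

lemma ruin_sets [measurable]:
  assumes "0 \<le> x1" "0 \<le> p1" "0 \<le> x2" "0 \<le> p2"
  shows "ruin x1 p1 x2 p2 \<in> sets M"
proof -
  have "Measurable.pred M (\<lambda>\<omega>. \<exists>k. max 0 (arrival W k \<omega>) \<le> T \<and> Xproc r W \<sigma> x p (max 0 (arrival W k \<omega>)) \<omega> < 0)" for x p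
  proof -
    have [measurable]: "(\<lambda>\<omega>. counting W (max 0 (arrival W k \<omega>)) \<omega>) \<in> measurable M (count_space UNIV)" for k
      unfolding counting_def by measurable
    have "(\<lambda>\<omega>. \<Sum>j\<in>{1..n}. exp (- r * arrival W j \<omega>) * \<sigma> j \<omega>) \<in> borel_measurable M" for n
      using measurable_claim by (intro borel_measurable_sum borel_measurable_times) auto
    then have [measurable]: "(\<lambda>\<omega>. \<Sum>j\<in>{1..counting W (max 0 (arrival W k \<omega>)) \<omega>}. exp (- r * arrival W j \<omega>) * \<sigma> j \<omega>) \<in> borel_measurable M" for k
      by (rule measurable_compose_countable) measurable
    show ?thesis
      unfolding Xproc_def by measurable
  qed
  note [measurable] = this
  have "ruin x1 p1 x2 p2 = {\<omega> \<in> space M.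
     (\<exists>k. max 0 (arrival W k \<omega>) \<le> T \<and> Xproc r W \<sigma> x1 p1 (max 0 (arrival W k \<omega>)) \<omega> < 0) \<or>
     (\<exists>k. max 0 (arrival W k \<omega>) \<le> T \<and> Xproc r W \<sigma> x2 p2 (max 0 (arrival W k \<omega>)) \<omega> < 0)}"
    using assms by (simp add: ruin_def bex_disj_distrib surplus_negative_iff)
  also have "\<dots> \<in> sets M"
    by measurable
  finally show ?thesis .
qed

text \<open>A sum of \<open>m + 1\<close> terms exceeding \<open>x\<close>, none of them above \<open>(1 - e) x\<close>, has two terms above
  \<open>e x / (m + 1)\<close>.\<close>

lemma ruin_subset:
  assumes "0 < e" "e < 1" "0 < x1" "x1 \<le> x2" "0 \<le> p1" "0 \<le> p2"
    and \<omega>: "regular_arrivals \<omega>" "\<omega> \<in> ruin x1 p1 x2 p2"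
  shows "\<exists>k. \<omega> \<in> large_claim ((1 - e) * x1) k \<or> \<omega> \<in> two_large_claims (e * x1 / real (Suc k)) k"
proof (rule ccontr)
  assume contr: "\<nexists>k. \<omega> \<in> large_claim ((1 - e) * x1) k \<or> \<omega> \<in> two_large_claims (e * x1 / real (Suc k)) k"
  from \<omega> have sp: "\<omega> \<in> space M"
    by (simp add: ruin_def)
  from \<omega>(2) obtain t where t: "0 \<le> t" "t \<le> T" and neg: "Xproc r W \<sigma> x1 p1 t \<omega> < 0 \<or> Xproc r W \<sigma> x2 p2 t \<omega> < 0"
    by (auto simp: ruin_def)
  define Y where "Y k = exp (- r * arrival W (Suc k) \<omega>) * \<sigma> (Suc k) \<omega>" for k
  \<comment> \<open>Premium income is nonnegative and \<open>x1 \<le> x2\<close>, so a negative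
    surplus of either component forces the discounted claims above \<open>x1\<close>.\<close>
  have "0 \<le> p * (1 - exp (- r * t))" if "0 \<le> p" for p
    using that t r_pos by (intro mult_nonneg_nonneg) auto
  with neg assms(4-6) have big: "x1 < (\<Sum>k\<in>{1..counting W t \<omega>}. exp (- r * arrival W k \<omega>) * \<sigma> k \<omega>)"
    by (fastforce simp: Xproc_def)
  then have "counting W t \<omega> \<noteq> 0"
    using \<open>0 < x1\<close> by (intro notI) simp
  then obtain m where m: "counting W t \<omega> = Suc m"
    using not0_implies_Suc by blast
  have arr: "arrival W (Suc k) \<omega> \<le> T" if "k \<le> m" for k
  proof -
    have "Suc k \<in> {1..counting W t \<omega>}"
      using that m by simp
    then show ?thesis
      using t unfolding counting_regular[OF \<omega>(1) t(2)] by simp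
  qed
  have "(\<Sum>k\<in>{1..Suc m}. exp (- r * arrival W k \<omega>) * \<sigma> k \<omega>) = sum Y {..m}"
    unfolding Y_def atMost_atLeast0 One_nat_def by (rule sum.shift_bounds_cl_Suc_ivl)
  with big m have sum: "x1 < sum Y {..m}"
    by simp
  have Y_le: "Y k \<le> (1 - e) * x1" if "k \<le> m" for k
    using contr arr[OF that] sp by (auto simp: large_claim_def Y_def not_less)
  have Y_le_claim: "Y k \<le> \<sigma> (Suc k) \<omega>" for k
  proof -
    have "0 \<le> arrival W (Suc k) \<omega>"
      using \<omega>(1) by (simp add: regular_arrivals_def arrival_def sum_nonneg)
    then have "exp (- r * arrival W (Suc k) \<omega>) \<le> 1"
      using r_pos by simp
    then show ?thesis
      unfolding Y_def using claim_nonneg[of "Suc k" \<omega>] sp by (intro mult_left_le_one_le) auto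
  qed
  let ?d = "e * x1 / real (Suc m)"
  have d: "0 < ?d"
    using assms by simp
  have small: "Y i \<le> ?d \<or> Y j \<le> ?d" if "i \<le> m" "j \<le> m" "i \<noteq> j" for i j
  proof (rule ccontr)
    assume "\<not> (Y i \<le> ?d \<or> Y j \<le> ?d)"
    then have "?d < \<sigma> (Suc i) \<omega>" "?d < \<sigma> (Suc j) \<omega>"
      using Y_le_claim[of i] Y_le_claim[of j] by linarith+
    then have "\<omega> \<in> two_large_claims ?d m"
      unfolding two_large_claims_def using that sp arr[of m]
      by (cases i j rule: linorder_cases) auto
    with contr show False
      by blast
  qed
  have le: "sum Y {..m} \<le> Y i + real m * ?d" if "i \<le> m" "\<And>j. j \<le> m \<Longrightarrow> j \<noteq> i \<Longrightarrow> Y j \<le> ?d" for i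
  proof -
    have "sum Y {..m} = Y i + sum Y ({..m} - {i})"
      using that by (intro sum.remove) auto
    also have "sum Y ({..m} - {i}) \<le> of_nat (card ({..m} - {i})) * ?d"
      using that by (intro sum_bounded_above) auto
    finally show ?thesis
      using that by simp
  qed
  \<comment> \<open>Since \<open>real (Suc m) * ?d = e * x1\<close>, one term of at most
    \<open>(1 - e) * x1\<close> and \<open>m\<close> terms of at most \<open>?d\<close> add up to at
    most \<open>x1 - ?d\<close>, against \<open>x1 < sum Y {..m}\<close>.\<close>
  have "real m * ?d \<le> e * x1 - ?d"
    by (simp add: field_simps)
  moreover have "\<exists>i\<le>m. \<forall>j\<le>m. j \<noteq> i \<longrightarrow> Y j \<le> ?d"
  proof (cases "\<exists>i\<le>m. ?d < Y i")
    case True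
    then obtain i where "i \<le> m" "?d < Y i"
      by blast
    then show ?thesis
      using small[of i] by (intro exI[of _ i]) (auto simp: not_le)
  next
    case False
    then show ?thesis
      by (intro exI[of _ 0]) (auto simp: not_less)
  qed
  then obtain i where "i \<le> m" "\<And>j. j \<le> m \<Longrightarrow> j \<noteq> i \<Longrightarrow> Y j \<le> ?d"
    by blast
  then have "sum Y {..m} \<le> Y i + real m * ?d" "Y i \<le> (1 - e) * x1"
    using le Y_le by auto
  ultimately show False
    using sum d by (simp add: algebra_simps)
qed

text \<open>When this claim arrives, the premium income is at most \<open>p1\<close> and the other
  claims are nonnegative, so the first component is already ruined.\<close>

lemma large_claim_subset_ruin:
  assumes "0 \<le> x1" "0 \<le> p1" and \<omega>: "regular_arrivals \<omega>" "\<omega> \<in> large_claim (x1 + p1) k"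
  shows "\<omega> \<in> ruin x1 p1 x2 p2"
proof -
  let ?t = "arrival W (Suc k) \<omega>"
  have sp: "\<omega> \<in> space M" and t: "?t \<le> T" and big: "x1 + p1 < exp (- r * ?t) * \<sigma> (Suc k) \<omega>"
    using \<omega> by (auto simp: large_claim_def)
  have "Suc k \<in> {1..counting W ?t \<omega>}"
    using counting_regular[OF \<omega>(1) t] by (auto simp: set_eq_iff)
  then have "(\<Sum>j\<in>{Suc k}. exp (- r * arrival W j \<omega>) * \<sigma> j \<omega>)
      \<le> (\<Sum>j\<in>{1..counting W ?t \<omega>}. exp (- r * arrival W j \<omega>) * \<sigma> j \<omega>)"
    using claim_nonneg sp by (intro sum_mono2) auto
  moreover have "p1 * (1 - exp (- r * ?t)) \<le> p1 * 1"
    using assms by (intro mult_left_mono) auto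
  ultimately have "Xproc r W \<sigma> x1 p1 ?t \<omega> < 0"
    using big by (simp add: Xproc_def)
  moreover have "0 \<le> ?t"
    using \<omega>(1) by (simp add: regular_arrivals_def arrival_def sum_nonneg)
  ultimately show ?thesis
    using sp t by (auto simp: ruin_def)
qed

section \<open>Lower bound for the ruin probability\<close>

text \<open>The constant, independent of the initial reserves, in front of the squared tails: at 1
  for the lower bound, at \<open>D\<^sup>2\<close> for the upper one.\<close>

definition arrival_series :: "real \<Rightarrow> real" where
  "arrival_series D = (\<Sum>k. prob {\<omega> \<in> space M. arrival W (Suc k) \<omega> \<le> T} * (real (Suc k))\<^sup>2 * D ^ k)"

lemma arrival_series_nonneg: "0 \<le> D \<Longrightarrow> 0 \<le> arrival_series D"
  unfolding arrival_series_def by (intro suminf_nonneg summable_arrival) auto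

text \<open>Bonferroni's inequality for the first \<open>n\<close> large claims, then
  \<open>n\<close> to infinity. Almost surely discounting only shrinks claims, so an overlap with
  \<open>j < k\<close> costs at most the arrival probability of claim \<open>Suc k\<close> times a
  squared tail; the \<open>k\<close> such pairs are rounded up to the square in
  \<open>arrival_series\<close>.\<close>

lemma prob_ruin_ge:
  assumes "0 \<le> x1" "0 \<le> p1" "0 \<le> x2" "0 \<le> p2"
  shows "lam * T * Fbar_T M r \<sigma> T (x1 + p1) - arrival_series 1 * (tail (x1 + p1))\<^sup>2 \<le> prob (ruin x1 p1 x2 p2)"
proof -
  let ?L = "large_claim (x1 + p1)" and ?c = "\<lambda>k. prob {\<omega> \<in> space M. arrival W (Suc k) \<omega> \<le> T}"
  have pair: "prob (?L j \<inter> ?L k) \<le> ?c k * (tail (x1 + p1))\<^sup>2" if "j < k" for j k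
  proof -
    have "prob (?L j \<inter> ?L k) \<le> prob {\<omega> \<in> space M. arrival W (Suc k) \<omega> \<le> T \<and>
        \<sigma> (Suc j) \<omega> > x1 + p1 \<and> \<sigma> (Suc k) \<omega> > x1 + p1}"
    proof (rule finite_measure_mono_AE)
      show "AE \<omega> in M. \<omega> \<in> ?L j \<inter> ?L k \<longrightarrow> \<omega> \<in> {\<omega> \<in> space M. arrival W (Suc k) \<omega> \<le> T \<and>
        \<sigma> (Suc j) \<omega> > x1 + p1 \<and> \<sigma> (Suc k) \<omega> > x1 + p1}"
        using AE_regular_arrivals AE_space
      proof eventually_elim
        fix \<omega> assume "regular_arrivals \<omega>" and sp: "\<omega> \<in> space M"
        then have "0 \<le> arrival W i \<omega>" for i
          by (simp add: regular_arrivals_def arrival_def sum_nonneg)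
        then have "exp (- r * arrival W (Suc i) \<omega>) * \<sigma> (Suc i) \<omega> \<le> \<sigma> (Suc i) \<omega>" for i
          using claim_nonneg[of "Suc i" \<omega>] sp r_pos by (intro mult_left_le_one_le) auto
        then show "\<omega> \<in> ?L j \<inter> ?L k \<longrightarrow> \<omega> \<in> {\<omega> \<in> space M. arrival W (Suc k) \<omega> \<le> T \<and>
            \<sigma> (Suc j) \<omega> > x1 + p1 \<and> \<sigma> (Suc k) \<omega> > x1 + p1}"
          unfolding large_claim_def by (auto intro: less_le_trans)
      qed
    qed measurable
    also have "\<dots> = ?c k * (tail (x1 + p1))\<^sup>2"
      using that by (intro prob_arrival_two_claims) auto
    finally show ?thesis .
  qed
  have union: "prob (\<Union>k<n. ?L k) \<le> prob (ruin x1 p1 x2 p2)" for n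
  proof (rule finite_measure_mono_AE)
    show "AE \<omega> in M. \<omega> \<in> (\<Union>k<n. ?L k) \<longrightarrow> \<omega> \<in> ruin x1 p1 x2 p2"
      using AE_regular_arrivals by eventually_elim (use assms large_claim_subset_ruin in blast)
  qed (use assms in measurable)
  have "(\<Sum>k<n. prob (?L k)) \<le> prob (ruin x1 p1 x2 p2) + arrival_series 1 * (tail (x1 + p1))\<^sup>2" for n
  proof -
    have "(\<Sum>k<n. \<Sum>j<k. prob (?L j \<inter> ?L k)) \<le> (\<Sum>k<n. ?c k * (real (Suc k))\<^sup>2 * 1 ^ k * (tail (x1 + p1))\<^sup>2)"
    proof (rule sum_mono)
      fix k
      have "(\<Sum>j<k. prob (?L j \<inter> ?L k)) \<le> of_nat (card {..<k}) * (?c k * (tail (x1 + p1))\<^sup>2)"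
        by (rule sum_bounded_above) (simp add: pair)
      also have "\<dots> \<le> (real (Suc k))\<^sup>2 * (?c k * (tail (x1 + p1))\<^sup>2)"
        by (intro mult_right_mono) (auto simp: power2_eq_square algebra_simps)
      finally show "(\<Sum>j<k. prob (?L j \<inter> ?L k)) \<le> ?c k * (real (Suc k))\<^sup>2 * 1 ^ k * (tail (x1 + p1))\<^sup>2"
        by (simp add: ac_simps)
    qed
    also have "\<dots> \<le> arrival_series 1 * (tail (x1 + p1))\<^sup>2"
      unfolding arrival_series_def sum_distrib_right[symmetric]
      by (intro mult_right_mono sum_le_suminf summable_arrival) auto
    finally show ?thesis
      using bonferroni_lower[of ?L n] union[of n] by auto
  qed
  then have "lam * T * Fbar_T M r \<sigma> T (x1 + p1) \<le> prob (ruin x1 p1 x2 p2) + arrival_series 1 * (tail (x1 + p1))\<^sup>2"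
    using sums_large_claim[of "x1 + p1"] unfolding sums_def by (intro LIMSEQ_le_const2) auto
  then show ?thesis
    by simp
qed

section \<open>Comparing the mean number of large claims with the tail\<close>

text \<open>Both means integrate tails at the levels \<open>x * exp (r * t)\<close> and
  \<open>y * exp (r * t)\<close>, so estimates for the claim tail pass to \<open>Fbar_T\<close>
  pointwise under the integral.\<close>

lemma claim_mean_mono:
  assumes "0 \<le> a" "0 \<le> b"
    and "\<And>t. 0 < t \<Longrightarrow> t \<le> T \<Longrightarrow> a * tail (x * exp (r * t)) \<le> b * tail (y * exp (r * t))"
  shows "a * (lam * T * Fbar_T M r \<sigma> T x) \<le> b * (lam * T * Fbar_T M r \<sigma> T y)"
proof -
  have eq: "ennreal (c * (lam * T * Fbar_T M r \<sigma> T z))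
      = (\<integral>\<^sup>+t. ennreal (c * (lam * tail (z * exp (r * t)))) * indicator {0<..T} t \<partial>lborel)" if "0 \<le> c" for c z
    using that unfolding ennreal_mult'[OF that] claim_mean_eq mult.assoc[of "ennreal c"]
    by (intro nn_integral_cmult[symmetric]) (auto intro!: measurable_compose[OF _ measurable_tail])
  have "ennreal (a * (lam * T * Fbar_T M r \<sigma> T x)) \<le> ennreal (b * (lam * T * Fbar_T M r \<sigma> T y))"
    unfolding eq[OF assms(1)] eq[OF assms(2)]
  proof (rule nn_integral_mono)
    fix t
    show "ennreal (a * (lam * tail (x * exp (r * t)))) * indicator {0<..T} t
        \<le> ennreal (b * (lam * tail (y * exp (r * t)))) * indicator {0<..T} t"
      using mult_left_mono[OF assms(3)[of t], of lam] lam_pos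
      by (auto simp: indicator_def ac_simps intro!: ennreal_leI)
  qed
  then show ?thesis
    using assms lam_pos T_pos Fbar_T_nonneg[of y] by (subst (asm) ennreal_le_iff) auto
qed

text \<open>The integrand of \<open>claim_mean_eq\<close> decreases in \<open>t\<close>, so its
  value at \<open>T\<close> bounds it below.\<close>

lemma tail_le_claim_mean:
  assumes "0 \<le> x"
  shows "lam * T * tail (x * exp (r * T)) \<le> lam * T * Fbar_T M r \<sigma> T x"
proof -
  let ?c = "lam * tail (x * exp (r * T))"
  have "ennreal (?c * T) = (\<integral>\<^sup>+t. ennreal ?c * indicator {0<..T} t \<partial>lborel)"
    using T_pos lam_pos by (simp add: nn_integral_cmult_indicator ennreal_mult)
  also have "\<dots> \<le> ennreal (lam * T * Fbar_T M r \<sigma> T x)"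
    unfolding claim_mean_eq
  proof (rule nn_integral_mono)
    fix t
    show "ennreal ?c * indicator {0<..T} t \<le> ennreal (lam * tail (x * exp (r * t))) * indicator {0<..T} t"
      using lam_pos r_pos assms
      by (auto simp: indicator_def intro!: ennreal_leI mult_left_mono tail_antimono)
  qed
  finally show ?thesis
    using lam_pos T_pos Fbar_T_nonneg[of x] by (subst (asm) ennreal_le_iff) (auto simp: ac_simps)
qed

end

section \<open>Upper bound under a doubling condition\<close>

text \<open>Doubling is required at every positive \<open>x\<close>, not just eventually: for fixed
  \<open>x1\<close> the levels \<open>e * x1 / real (Suc k)\<close> tend to zero as \<open>k\<close>
  grows.\<close>

locale doubling_claims = discounted_claims +
  fixes D :: real
  assumes D_nonneg: "0 \<le> D"
    and tail_half: "\<And>x. 0 < x \<Longrightarrow> tail (x / 2) \<le> D * tail x"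
    and tail_pos: "\<And>x. 0 < tail x"
begin

text \<open>Iterate the doubling \<open>Suc k\<close> times and use
  \<open>real (Suc k) \<le> 2 ^ Suc k\<close>.\<close>

lemma tail_divide:
  assumes "0 < x"
  shows "tail (x / real (Suc k)) \<le> D ^ Suc k * tail x"
proof -
  have "tail (x / 2 ^ n) \<le> D ^ n * tail x" for n
  proof (induction n)
    case (Suc n)
    have "tail (x / 2 ^ Suc n) \<le> D * tail (x / 2 ^ n)"
      using tail_half[of "x / 2 ^ n"] assms by (simp add: mult.commute)
    also have "\<dots> \<le> D * (D ^ n * tail x)"
      using Suc D_nonneg by (intro mult_left_mono)
    finally show ?case
      by simp
  qed simp
  moreover have "tail (x / real (Suc k)) \<le> tail (x / 2 ^ Suc k)"
    using assms less_imp_le[OF of_nat_less_two_power[where 'a=real, of "Suc k"]]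
    by (intro tail_antimono divide_left_mono) auto
  ultimately show ?thesis
    by (rule order_trans[rotated])
qed

text \<open>Union bound over the events of \<open>ruin_subset\<close>. Single large claims add up to
  the mean; pairs among \<open>Suc k\<close> claims cost \<open>D ^ (2 * Suc k)\<close>, of which
  \<open>D\<^sup>2\<close> is taken out of the series.\<close>

lemma prob_ruin_le:
  assumes "0 < e" "e < 1" "0 < x1" "x1 \<le> x2" "0 \<le> p1" "0 \<le> p2"
  shows "prob (ruin x1 p1 x2 p2)
    \<le> lam * T * Fbar_T M r \<sigma> T ((1 - e) * x1) + arrival_series (D\<^sup>2) * D\<^sup>2 * (tail (e * x1))\<^sup>2"
proof -
  let ?L = "large_claim ((1 - e) * x1)" and ?B = "\<lambda>k. two_large_claims (e * x1 / real (Suc k)) k"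
  let ?c = "\<lambda>k. prob {\<omega> \<in> space M. arrival W (Suc k) \<omega> \<le> T}"
  have "prob (ruin x1 p1 x2 p2) \<le> prob ((\<Union>k. ?L k) \<union> (\<Union>k. ?B k))"
  proof (rule finite_measure_mono_AE)
    show "AE \<omega> in M. \<omega> \<in> ruin x1 p1 x2 p2 \<longrightarrow> \<omega> \<in> (\<Union>k. ?L k) \<union> (\<Union>k. ?B k)"
      using AE_regular_arrivals
    proof eventually_elim
      fix \<omega> assume "regular_arrivals \<omega>"
      then show "\<omega> \<in> ruin x1 p1 x2 p2 \<longrightarrow> \<omega> \<in> (\<Union>k. ?L k) \<union> (\<Union>k. ?B k)"
        using ruin_subset[OF assms] by blast
    qed
  qed measurable
  also have "\<dots> \<le> prob (\<Union>k. ?L k) + prob (\<Union>k. ?B k)"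
    by (rule measure_Un_le) measurable
  also have "prob (\<Union>k. ?L k) \<le> lam * T * Fbar_T M r \<sigma> T ((1 - e) * x1)"
    using finite_measure_subadditive_countably[of ?L] sums_large_claim[of "(1 - e) * x1"]
    by (simp add: sums_iff image_subset_iff)
  also have "prob (\<Union>k. ?B k) \<le> arrival_series (D\<^sup>2) * D\<^sup>2 * (tail (e * x1))\<^sup>2"
  proof -
    let ?f = "\<lambda>k. ?c k * (real (Suc k))\<^sup>2 * (D\<^sup>2) ^ k"
    have sm: "summable ?f"
      by (rule summable_arrival) simp
    have le: "prob (?B k) \<le> ?f k * (D\<^sup>2 * (tail (e * x1))\<^sup>2)" for k
    proof -
      have "(tail (e * x1 / real (Suc k)))\<^sup>2 \<le> (D ^ Suc k * tail (e * x1))\<^sup>2"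
        using assms by (intro power_mono tail_divide) auto
      also have "\<dots> = (D\<^sup>2) ^ k * (D\<^sup>2 * (tail (e * x1))\<^sup>2)"
        by (simp add: power_mult_distrib power2_eq_square ac_simps)
      finally have *: "(tail (e * x1 / real (Suc k)))\<^sup>2 \<le> (D\<^sup>2) ^ k * (D\<^sup>2 * (tail (e * x1))\<^sup>2)" .
      have le: "?c k * (real (Suc k))\<^sup>2 * (tail (e * x1 / real (Suc k)))\<^sup>2
          \<le> ?c k * (real (Suc k))\<^sup>2 * ((D\<^sup>2) ^ k * (D\<^sup>2 * (tail (e * x1))\<^sup>2))"
        by (intro mult_left_mono *) auto
      show ?thesis
        using order_trans[OF prob_two_large_claims_le le] by (simp only: mult.assoc)
    qed
    have sm': "summable (\<lambda>k. prob (?B k))"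
      by (rule summable_comparison_test'[OF summable_mult2[OF sm], of 0]) (use le in simp)
    have "prob (\<Union>k. ?B k) \<le> (\<Sum>k. prob (?B k))"
      by (rule finite_measure_subadditive_countably) (use sm' in auto)
    also have "\<dots> \<le> (\<Sum>k. ?f k * (D\<^sup>2 * (tail (e * x1))\<^sup>2))"
      by (intro suminf_le le sm' summable_mult2 sm)
    also have "\<dots> = arrival_series (D\<^sup>2) * (D\<^sup>2 * (tail (e * x1))\<^sup>2)"
      unfolding arrival_series_def by (rule suminf_mult2[OF sm, symmetric])
    finally show ?thesis
      by (simp add: mult.assoc)
  qed
  finally show ?thesis
    by simp
qed

lemma claim_mean_pos: "0 \<le> x \<Longrightarrow> 0 < lam * T * Fbar_T M r \<sigma> T x"
  using tail_le_claim_mean[of x] lam_pos T_pos tail_pos[of "x * exp (r * T)"]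
  by (auto intro: less_le_trans)

section \<open>Asymptotics of the ruin probability\<close>

text \<open>One factor \<open>tail (e * x)\<close> is at most a constant times the mean, while the
  other tends to zero.\<close>

lemma tail_square_negligible:
  assumes "0 < e"
  shows "((\<lambda>x. (tail (e * x))\<^sup>2 / (lam * T * Fbar_T M r \<sigma> T x)) \<longlongrightarrow> 0) at_top"
proof -
  \<comment> \<open>This \<open>m\<close> gives
    \<open>x * exp (r * T) / real (Suc m) \<le> e * x\<close>, so \<open>tail_divide\<close> bounds
    \<open>tail (e * x)\<close> by a multiple of \<open>tail (x * exp (r * T))\<close>, which
    \<open>tail_le_claim_mean\<close> compares with the mean.\<close>
  obtain m where m: "exp (r * T) / e \<le> real m"
    using real_arch_simple by blast
  define C where "C = D ^ Suc m / (lam * T)"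
  have bound: "(tail (e * x))\<^sup>2 / (lam * T * Fbar_T M r \<sigma> T x) \<le> C * tail (e * x)" if "0 < x" for x
  proof -
    have "x * exp (r * T) / real (Suc m) \<le> e * x"
    proof -
      have "exp (r * T) \<le> e * real (Suc m)"
        using m assms by (simp add: field_simps)
      then have "x * exp (r * T) \<le> x * (e * real (Suc m))"
        using that by (intro mult_left_mono) auto
      then show ?thesis
        by (simp add: field_simps)
    qed
    then have "tail (e * x) \<le> D ^ Suc m * tail (x * exp (r * T))"
      using tail_divide[of "x * exp (r * T)" m] that by (meson exp_gt_zero mult_pos_pos order_trans tail_antimono)
    also have "\<dots> = C * (lam * T * tail (x * exp (r * T)))"
      using lam_pos T_pos by (simp add: C_def)
    also have "\<dots> \<le> C * (lam * T * Fbar_T M r \<sigma> T x)"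
      using that lam_pos T_pos D_nonneg by (intro mult_left_mono tail_le_claim_mean) (auto simp: C_def)
    finally have "tail (e * x) * tail (e * x) \<le> C * (lam * T * Fbar_T M r \<sigma> T x) * tail (e * x)"
      by (intro mult_right_mono) auto
    then show ?thesis
      using claim_mean_pos[of x] that by (simp add: pos_divide_le_eq power2_eq_square ac_simps)
  qed
  have "filterlim (\<lambda>x. e * x) at_top at_top"
    using assms by (intro filterlim_tendsto_pos_mult_at_top[OF tendsto_const _ filterlim_ident])
  then have "((\<lambda>x. C * tail (e * x)) \<longlongrightarrow> C * 0) at_top"
    by (intro tendsto_mult tendsto_const filterlim_compose[OF tail_tendsto_0])
  then have lim: "((\<lambda>x. C * tail (e * x)) \<longlongrightarrow> 0) at_top"
    by simp
  show ?thesis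
  proof (rule tendsto_sandwich[OF _ _ tendsto_const lim])
    show "\<forall>\<^sub>F x in at_top. 0 \<le> (tail (e * x))\<^sup>2 / (lam * T * Fbar_T M r \<sigma> T x)"
      using lam_pos T_pos Fbar_T_nonneg by (intro always_eventually) auto
    show "\<forall>\<^sub>F x in at_top. (tail (e * x))\<^sup>2 / (lam * T * Fbar_T M r \<sigma> T x) \<le> C * tail (e * x)"
      using eventually_gt_at_top[of 0] by eventually_elim (rule bound)
  qed
qed

text \<open>One half of \<open>\<epsilon>\<close> pays for moving the level from \<open>x1\<close>
  to \<open>(1 - e) * x1\<close> or \<open>x1 + p1\<close>, the other for the squared tail. Both
  bounds on the ruin probability are free of \<open>x2\<close>, which makes \<open>A\<close> uniform
  in it.\<close>

lemma ruin_asymptotics: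
  fixes \<alpha> \<epsilon> :: real
  assumes rv: "\<And>c. 0 < c \<Longrightarrow> ((\<lambda>x. tail (c * x) / tail x) \<longlongrightarrow> c powr (- \<alpha>)) at_top"
    and p: "0 \<le> p1" "0 \<le> p2" and \<epsilon>: "0 < \<epsilon>"
  shows "\<exists>A. \<forall>x1 x2. A \<le> x1 \<and> x1 \<le> x2 \<longrightarrow>
    \<bar>prob (ruin x1 p1 x2 p2) / (lam * T * Fbar_T M r \<sigma> T x1) - 1\<bar> < \<epsilon>"
proof -
  let ?H = "\<lambda>x. lam * T * Fbar_T M r \<sigma> T x"
  have "((\<lambda>e. (1 - e) powr (- \<alpha>)) \<longlongrightarrow> (1 - 0) powr (- \<alpha>)) (at_right 0)"
    by (intro tendsto_intros) auto
  then have "\<forall>\<^sub>F e in at_right 0. (1 - e) powr (- \<alpha>) < 1 + \<epsilon> / 2"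
    by (rule order_tendstoD(2)) (use \<epsilon> in simp)
  moreover have "((\<lambda>e. (1 + e) powr (- \<alpha>)) \<longlongrightarrow> (1 + 0) powr (- \<alpha>)) (at_right 0)"
    by (intro tendsto_intros) auto
  then have "\<forall>\<^sub>F e in at_right 0. 1 - \<epsilon> / 2 < (1 + e) powr (- \<alpha>)"
    by (rule order_tendstoD(1)) (use \<epsilon> in simp)
  moreover have "\<forall>\<^sub>F e in at_right 0. e \<in> {0<..<1::real}"
    by (rule eventually_at_right_real) simp
  ultimately have "\<forall>\<^sub>F e in at_right (0::real). 0 < e \<and> e < 1 \<and> (1 - e) powr (- \<alpha>) < 1 + \<epsilon> / 2 \<and> 1 - \<epsilon> / 2 < (1 + e) powr (- \<alpha>)"
    by eventually_elim auto
  then obtain e where e: "0 < e" "e < 1" "(1 - e) powr (- \<alpha>) < 1 + \<epsilon> / 2" "1 - \<epsilon> / 2 < (1 + e) powr (- \<alpha>)"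
    using eventually_happens'[OF trivial_limit_at_right_real] by blast
  define K where "K = arrival_series (D\<^sup>2) * D\<^sup>2"
  have K: "0 \<le> K"
    by (simp add: K_def arrival_series_nonneg)
  have "\<forall>\<^sub>F x in at_top. tail ((1 - e) * x) / tail x < 1 + \<epsilon> / 2"
    "\<forall>\<^sub>F x in at_top. 1 - \<epsilon> / 2 < tail ((1 + e) * x) / tail x"
    using order_tendstoD(2)[OF rv[of "1 - e"] e(3)] order_tendstoD(1)[OF rv[of "1 + e"] e(4)] e by auto
  moreover have "((\<lambda>x. K * ((tail (e * x))\<^sup>2 / ?H x)) \<longlongrightarrow> K * 0) at_top"
    by (intro tendsto_mult tendsto_const tail_square_negligible e)
  then have "\<forall>\<^sub>F x in at_top. K * ((tail (e * x))\<^sup>2 / ?H x) < \<epsilon> / 2"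
    by (rule order_tendstoD(2)) (use \<epsilon> in simp)
  moreover have "((\<lambda>x. arrival_series 1 * ((tail (1 * x))\<^sup>2 / ?H x)) \<longlongrightarrow> arrival_series 1 * 0) at_top"
    by (intro tendsto_mult tendsto_const tail_square_negligible zero_less_one)
  then have "\<forall>\<^sub>F x in at_top. arrival_series 1 * ((tail (1 * x))\<^sup>2 / ?H x) < \<epsilon> / 2"
    by (rule order_tendstoD(2)) (use \<epsilon> in simp)
  \<comment> \<open>From here on \<open>x1 + p1 \<le> (1 + e) * x1\<close>, so the bounded premium
    income is absorbed into the factor \<open>1 + e\<close>.\<close>
  moreover have "\<forall>\<^sub>F x in at_top. p1 / e \<le> x \<and> (0::real) < x"
    by (intro eventually_conj eventually_ge_at_top eventually_gt_at_top)
  ultimately have "\<forall>\<^sub>F x in at_top. tail ((1 - e) * x) / tail x < 1 + \<epsilon> / 2 \<and>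
      1 - \<epsilon> / 2 < tail ((1 + e) * x) / tail x \<and> K * ((tail (e * x))\<^sup>2 / ?H x) < \<epsilon> / 2 \<and>
      arrival_series 1 * ((tail x)\<^sup>2 / ?H x) < \<epsilon> / 2 \<and> p1 / e \<le> x \<and> 0 < x"
    by eventually_elim auto
  then obtain A where A: "\<And>x. A \<le> x \<Longrightarrow> tail ((1 - e) * x) / tail x < 1 + \<epsilon> / 2 \<and>
      1 - \<epsilon> / 2 < tail ((1 + e) * x) / tail x \<and> K * ((tail (e * x))\<^sup>2 / ?H x) < \<epsilon> / 2 \<and>
      arrival_series 1 * ((tail x)\<^sup>2 / ?H x) < \<epsilon> / 2 \<and> p1 / e \<le> x \<and> 0 < x"
    unfolding eventually_at_top_linorder by blast
  show ?thesis
  proof (intro exI[of _ A] allI impI)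
    fix x1 x2 assume "A \<le> x1 \<and> x1 \<le> x2"
    then have x: "A \<le> x1" "x1 \<le> x2" by auto
    note Ax = A[OF x(1)]
    have x1: "0 < x1" "p1 \<le> e * x1"
      using Ax e by (auto simp: field_simps)
    have H: "0 < ?H x1"
      using x1 by (intro claim_mean_pos) auto
    \<comment> \<open>The tail estimates are needed at all levels \<open>x1 * exp (r * t)\<close>
      under the integral; these stay above the threshold.\<close>
    have later: "A \<le> x1 * exp (r * t)" if "0 < t" for t
    proof -
      have "x1 * 1 \<le> x1 * exp (r * t)"
        using that x1 r_pos by (intro mult_left_mono) auto
      with x show ?thesis by simp
    qed
    have up: "?H ((1 - e) * x1) \<le> (1 + \<epsilon> / 2) * ?H x1"
    proof -
      have "1 * ?H ((1 - e) * x1) \<le> (1 + \<epsilon> / 2) * ?H x1"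
      proof (rule claim_mean_mono)
        fix t assume "0 < t" "t \<le> T"
        then have "tail ((1 - e) * (x1 * exp (r * t))) / tail (x1 * exp (r * t)) < 1 + \<epsilon> / 2"
          using A[OF later] by blast
        then show "1 * tail ((1 - e) * x1 * exp (r * t)) \<le> (1 + \<epsilon> / 2) * tail (x1 * exp (r * t))"
          using tail_pos by (simp add: divide_less_eq mult.assoc)
      qed (use \<epsilon> in auto)
      then show ?thesis by simp
    qed
    have low: "(1 - \<epsilon> / 2) * ?H x1 \<le> ?H (x1 + p1)"
    \<comment> \<open>\<open>claim_mean_mono\<close> requires nonnegative factors; if
      \<open>1 - \<epsilon> / 2\<close> is negative the bound follows from signs.\<close>
    proof (cases "\<epsilon> / 2 \<le> 1")
      case True
      have "(1 - \<epsilon> / 2) * ?H x1 \<le> 1 * ?H (x1 + p1)"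
      proof (rule claim_mean_mono)
        fix t assume "0 < t" "t \<le> T"
        then have "1 - \<epsilon> / 2 < tail ((1 + e) * (x1 * exp (r * t))) / tail (x1 * exp (r * t))"
          using A[OF later] by blast
        then have "(1 - \<epsilon> / 2) * tail (x1 * exp (r * t)) \<le> tail ((1 + e) * (x1 * exp (r * t)))"
          using tail_pos by (simp add: less_divide_eq)
        also have "\<dots> \<le> tail ((x1 + p1) * exp (r * t))"
          using x1 by (subst mult.assoc[symmetric], intro tail_antimono mult_right_mono) (auto simp: algebra_simps)
        finally show "(1 - \<epsilon> / 2) * tail (x1 * exp (r * t)) \<le> 1 * tail ((x1 + p1) * exp (r * t))"
          by simp
      qed (use True in auto)
      then show ?thesis by simp
    next
      case False
      then have "(1 - \<epsilon> / 2) * ?H x1 \<le> 0"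
        using H by (intro mult_nonpos_nonneg) auto
      also have "0 \<le> ?H (x1 + p1)"
        using claim_mean_pos[of "x1 + p1"] x1 p by simp
      finally show ?thesis .
    qed
    have "prob (ruin x1 p1 x2 p2) \<le> ?H ((1 - e) * x1) + K * (tail (e * x1))\<^sup>2"
      unfolding K_def using e x x1 p by (intro prob_ruin_le) auto
    moreover have "K * (tail (e * x1))\<^sup>2 < \<epsilon> / 2 * ?H x1"
      using Ax H by (simp add: pos_divide_less_eq)
    ultimately have "prob (ruin x1 p1 x2 p2) < (1 + \<epsilon>) * ?H x1"
      using up by (simp add: algebra_simps)
    then have "prob (ruin x1 p1 x2 p2) / ?H x1 < 1 + \<epsilon>"
      using H by (simp add: pos_divide_less_eq)
    moreover have "?H (x1 + p1) - arrival_series 1 * (tail (x1 + p1))\<^sup>2 \<le> prob (ruin x1 p1 x2 p2)"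
      using x x1 p by (intro prob_ruin_ge) auto
    moreover have "arrival_series 1 * (tail (x1 + p1))\<^sup>2 \<le> arrival_series 1 * (tail x1)\<^sup>2"
      using p by (intro mult_left_mono power_mono tail_antimono arrival_series_nonneg) auto
    moreover have "arrival_series 1 * (tail x1)\<^sup>2 < \<epsilon> / 2 * ?H x1"
      using Ax H by (simp add: pos_divide_less_eq)
    ultimately have "(1 - \<epsilon>) * ?H x1 < prob (ruin x1 p1 x2 p2)"
      using low by (simp add: algebra_simps)
    then have "1 - \<epsilon> < prob (ruin x1 p1 x2 p2) / ?H x1"
      using H by (simp add: pos_less_divide_eq)
    with \<open>prob (ruin x1 p1 x2 p2) / ?H x1 < 1 + \<epsilon>\<close>
    show "\<bar>prob (ruin x1 p1 x2 p2) / ?H x1 - 1\<bar> < \<epsilon>"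
      by (simp add: abs_less_iff)
  qed
qed

end

section \<open>From slow variation to doubling and regular variation\<close>

text \<open>Beyond some \<open>a\<close> the quotient is below \<open>l + 1\<close>. Before
  \<open>a\<close> the numerator is at most 1 and the denominator at least \<open>G a\<close>, so
  \<open>1 / G a\<close> serves there.\<close>

lemma doubling_of_limit_half:
  fixes G :: "real \<Rightarrow> real"
  assumes mono: "\<And>x y. x \<le> y \<Longrightarrow> G y \<le> G x" and le_1: "\<And>x. G x \<le> 1" and pos: "\<And>x. 0 < G x"
    and lim: "((\<lambda>x. G (1 / 2 * x) / G x) \<longlongrightarrow> l) at_top"
  obtains D where "0 \<le> D" "\<And>x. G (x / 2) \<le> D * G x"
proof -
  have "\<forall>\<^sub>F x in at_top. G (1 / 2 * x) / G x < l + 1"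
    by (rule order_tendstoD(2)[OF lim]) simp
  then obtain a where a: "\<And>x. a \<le> x \<Longrightarrow> G (1 / 2 * x) / G x < l + 1"
    unfolding eventually_at_top_linorder by blast
  define D where "D = max (l + 1) (1 / G a)"
  have "G (x / 2) \<le> D * G x" for x
  proof (cases "a \<le> x")
    case True
    have "G (x / 2) \<le> (l + 1) * G x"
      using a[OF True] pos[of x] by (simp add: divide_less_eq)
    also have "\<dots> \<le> D * G x"
      using pos[of x] by (intro mult_right_mono) (auto simp: D_def)
    finally show ?thesis .
  next
    case False
    have "G (x / 2) \<le> 1 / G a * G a"
      using le_1[of "x / 2"] pos[of a] by simp
    also have "\<dots> \<le> D * G x"
      using False pos[of a] mono[of x a] by (intro mult_mono) (auto simp: D_def less_imp_le le_max_iff_disj)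
    finally show ?thesis .
  qed
  moreover have "0 \<le> D"
    using pos[of a] by (simp add: D_def le_max_iff_disj)
  ultimately show thesis
    using that by blast
qed

lemma slowly_varying_quotient_tendsto:
  fixes G L :: "real \<Rightarrow> real"
  assumes "slowly_varying L" "0 < c" and G: "\<And>x. 0 < x \<Longrightarrow> G x = L x / x powr \<alpha>"
  shows "((\<lambda>x. G (c * x) / G x) \<longlongrightarrow> c powr (- \<alpha>)) at_top"
proof -
  have "((\<lambda>x. L (c * x) / L x * c powr (- \<alpha>)) \<longlongrightarrow> 1 * c powr (- \<alpha>)) at_top"
    using assms(1,2) by (intro tendsto_mult tendsto_const) (auto simp: slowly_varying_def)
  moreover have "\<forall>\<^sub>F x in at_top. L (c * x) / L x * c powr (- \<alpha>) = G (c * x) / G x"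
    using eventually_gt_at_top[of 0]
    by eventually_elim (use assms(2) in \<open>simp add: G powr_mult powr_minus field_simps\<close>)
  ultimately show ?thesis
    by (simp add: tendsto_cong)
qed

theorem theorem3p3:
  fixes M :: "'a measure" and W \<sigma> :: "nat \<Rightarrow> 'a \<Rightarrow> real"
    and r c1 c2 \<delta>1 \<delta>2 lam \<alpha> T :: real and L :: "real \<Rightarrow> real"
  assumes "prob_space M"
    and "r > 0" and "c1 > 0" and "c2 > 0"
    and "0 < \<delta>1" and "\<delta>1 < 1" and "0 < \<delta>2" and "\<delta>2 < 1" and "\<delta>1 + \<delta>2 = 1"
    and "c1 / \<delta>1 > c2 / \<delta>2"
    and "lam > 0"
    \<comment> \<open>Poisson process of intensity lambda: i.i.d. Exp(lambda) interarrival times W 0, W 1, ...;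
        claims sigma 1, sigma 2, ... i.i.d., nonnegative, and everything mutually independent\<close>
    and "prob_space.indep_vars M (\<lambda>_. borel)
           (\<lambda>i. case i of Inl k \<Rightarrow> W k | Inr k \<Rightarrow> \<sigma> k) (range Inl \<union> Inr ` {1..})"
    and "\<And>k. distributed M lborel (W k) (exponential_density lam)"
    and "\<And>k. k \<ge> 1 \<Longrightarrow> distr M borel (\<sigma> k) = distr M borel (\<sigma> 1)"
    and "\<And>k \<omega>. k \<ge> 1 \<Longrightarrow> \<omega> \<in> space M \<Longrightarrow> \<sigma> k \<omega> \<ge> 0"
    \<comment> \<open>regularly varying tail with slowly varying L tending to infinity\<close>
    and "\<alpha> > 0"
    and "\<And>k x. k \<ge> 1 \<Longrightarrow> x > 0 \<Longrightarrow>
           measure M {\<omega> \<in> space M. \<sigma> k \<omega> > x} = L x / x powr \<alpha>"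
    and "continuous_on {0<..} L" and "slowly_varying L" and "filterlim L at_top at_top"
    and "T > 0"
  shows "\<forall>\<epsilon>>0. \<exists>A. \<forall>x1 x2. A \<le> x1 \<and> x1 \<le> x2 \<longrightarrow>
           \<bar>Psi_min M r W \<sigma> (c1 / (r * \<delta>1)) (c2 / (r * \<delta>2)) x1 x2 T
              / (lam * T * Fbar_T M r \<sigma> T x1) - 1\<bar> < \<epsilon>"
proof (intro allI impI)
  fix \<epsilon> :: real assume "0 < \<epsilon>"
  interpret discounted_claims M W \<sigma> r lam T
    by (intro discounted_claims.intro discounted_claims_axioms.intro) fact+
  have tail_eq: "tail x = L x / x powr \<alpha>" if "0 < x" for x
    unfolding tail_def using assms(17)[of 1 x] that by simp
  \<comment> \<open>The tail formula holds only for positive arguments and \<open>L\<close> is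
    positive only eventually; a larger \<open>y\<close> meets both conditions, and monotonicity
    carries positivity back to \<open>x\<close>.\<close>
  have pos: "0 < tail x" for x
  proof -
    have "\<forall>\<^sub>F y in at_top. 0 < L y \<and> max 1 x \<le> y"
      using assms(19) by (intro eventually_conj eventually_ge_at_top) (simp add: slowly_varying_def)
    then obtain y where "0 < L y" "max 1 x \<le> y"
      using eventually_happens'[OF trivial_limit_at_top_linorder] by blast
    then have "0 < tail y"
      by (simp add: tail_eq)
    also have "tail y \<le> tail x"
      using \<open>max 1 x \<le> y\<close> by (intro tail_antimono) simp
    finally show ?thesis .
  qed
  have rv: "((\<lambda>x. tail (c * x) / tail x) \<longlongrightarrow> c powr (- \<alpha>)) at_top" if "0 < c" for c
    using assms(19) that tail_eq by (rule slowly_varying_quotient_tendsto)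
  obtain D where "0 \<le> D" "\<And>x. tail (x / 2) \<le> D * tail x"
    using doubling_of_limit_half[of tail, OF tail_antimono tail_le_1 pos rv[of "1 / 2"]] by auto
  then interpret doubling_claims M W \<sigma> r lam T D
    by unfold_locales (auto simp: pos)
  have "0 \<le> c1 / (r * \<delta>1)" "0 \<le> c2 / (r * \<delta>2)"
    using assms(2-7) by auto
  from ruin_asymptotics[OF rv this \<open>0 < \<epsilon>\<close>]
  show "\<exists>A. \<forall>x1 x2. A \<le> x1 \<and> x1 \<le> x2 \<longrightarrow>
           \<bar>Psi_min M r W \<sigma> (c1 / (r * \<delta>1)) (c2 / (r * \<delta>2)) x1 x2 T
              / (lam * T * Fbar_T M r \<sigma> T x1) - 1\<bar> < \<epsilon>"
    by (simp add: Psi_min_def ruin_def)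
qed

end
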